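(* Let $D=(V,A)$ be the digraph of the crew pairing pricing subproblem for a period of four consecutive days, with arc resources $q_a\in M=M^{\rho}\times\mathbb{R}$ and cost and infeasibility functions $c:M\to\mathbb{R}$ and $\rho:M\to\{0,1\}$ (all defined in the context). Let $P$ be an $o$-$d$ path in $D$ and let $p$ be the corresponding sequence of flight legs. Then $p$ is in $\mathcal{P}$ (i.e., is a feasible pairing) if and only if $\rho(q_P)=0$. In that case, $c(q_P)=\tilde{c}_p$.
   Context: Flight legs and pairings. A flight leg has departure and arrival airports and departure and arrival times (departure before arrival). A connection is a pair $(\ell,\ell')$ of flight legs such that the arrival airport of $\ell$ is the departure airport of $\ell'$ and the departure time of $\ell'$ minus the arrival time of $\ell$ is bounded from below by a fixed (positive) quantity, which can depend on the airport, the time and the fleet. It is a day connection if the arrival of $\ell$ and the departure of $\ell'$ are on the same day, and a night connection otherwise. A night connection whose duration is smaller than a given threshold is a reduced rest. A pairing is a sequence of distinct flight legs such that any two consecutive legs form a connection. A duty of a pairing is the subsequence formed by all its flight legs operated during a same day; two consecutive legs of the pairing belong to the same duty exactly when they form a day connection. A pairing $\ell_1,\ldots,\ell_k$ is feasible, i.e., belongs to $\mathcal{P}$, if it satisfies: (a) the period between the departure of $\ell_1$ and the arrival of $\ell_k$ spans at most 4 days; (b) $\ell_1$ starts and $\ell_k$ ends in one of the Paris airports; (c) each duty contains at most 4 flight legs, and if a duty starts with a leg $\ell'$ such that the night connection $(\ell,\ell')$ of the pairing leading to $\ell'$ is a reduced rest, then the duty contains at most 3 legs; (d) the total flying duration in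 a duty does not exceed $F(t)$, where $F$ is a given nonnegative function and $t$ is the time at which the first leg of the duty departs. Let $F_{\mathrm{m}}=\max_t F(t)$ and let $f(\ell)\geq 0$ be the flying duration of leg $\ell$. Reduced cost. Given real numbers $c_{(\ell,\ell')}$ for each connection and $z_\ell$ for each leg (dual variables), the reduced cost of a pairing $p$ is $\tilde{c}_p=\sum_{(\ell,\ell')\in p}c_{(\ell,\ell')}+\sum_{\ell\in p}z_\ell$, the first sum being over pairs of consecutive legs of $p$. Digraph. Let $\mathcal{L}$ be the set of legs of four given consecutive days. $V=\mathcal{L}\cup\{o,d\}$ where $o$ and $d$ are dummy origin and destination vertices. $A$ contains an arc $(o,\ell)$ for each leg $\ell$ starting in Paris on the first day of the period, an arc $(\ell,d)$ for each leg $\ell$ ending in Paris, and an arc $(\ell,\ell')$ for each connection $(\ell,\ell')$. The sequence of flight legs corresponding to an $o$-$d$ path is the sequence of its vertices other than $o$ and $d$. Monoid. $M^{\rho}=(\mathbb{Z}_+\times\mathbb{R}_+)\cup(\mathbb{Z}_+\times\mathbb{R}_+)^2\cup\{\infty\}$, with operation $\oplus$: - $r\oplus\infty=\infty\oplus r=\infty$ for all $r\in M^{\rho}$; - $(n,f)\oplus(\tilde n,\tilde f)=(n+\tilde n,f+\tilde f)$; - $(n,f)\oplus(\tilde n^b,\tilde f^b,\tilde n^e,\tilde f^e)=(n+\tilde n^b,f+\tilde f^b,\tilde n^e,\tilde f^e)$; - $(n^b,f^b,n^e,f^e)\oplus(\tilde n,\tilde f)=(n^b,f^b,n^e+\tilde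 n,f^e+\tilde f)$; - $(n^b,f^b,n^e,f^e)\oplus(\tilde n^b,\tilde f^b,\tilde n^e,\tilde f^e)=\infty$ if $n^e+\tilde n^b>4$ or $f^e+\tilde f^b>F_{\mathrm{m}}$, and $=(n^b,f^b,\tilde n^e,\tilde f^e)$ otherwise. $M=M^{\rho}\times\mathbb{R}$ is endowed with the componentwise sum (again denoted $\oplus$), with usual addition on $\mathbb{R}$. Arc resources. - If $(\ell,\ell')$ is a day connection, its resource is $((1,f(\ell')),\,c_{(\ell,\ell')}+z_{\ell'})$. - If $(\ell,\ell')$ is a night connection, its resource is $((0,0,n^e,f^e),\,c_{(\ell,\ell')}+z_{\ell'})$ where $n^e=2$ if $(\ell,\ell')$ is a reduced rest and $n^e=1$ otherwise, and $f^e=f(\ell')+F_{\mathrm{m}}-F(t)$ with $t$ the departure time of $\ell'$. - An arc $(o,\ell')$ has resource $((0,0,1,f^e),z_{\ell'})$ with $f^e=f(\ell')+F_{\mathrm{m}}-F(t)$, $t$ the departure time of $\ell'$. - An arc $(\ell,d)$ has resource $((0,0,0,0),0)$. The resource of a path $P$ is $q_P=\bigoplus_{a\in P}q_a$, summed in the order of the arcs along $P$. Cost and infeasibility functions. For $(r,z)\in M$, $c((r,z))=z$ and $\rho((r,z))=\rho_{M^\rho}(r)$, where, with $\mathbf{1}_I$ the indicator function of a set $I$, - $\rho_{M^\rho}((n,f))=\max(\mathbf{1}_{(4,\infty)}(n),\mathbf{1}_{(F_{\mathrm{m}},\infty)}(f))$; - $\rho_{M^\rho}((n^b,f^b,n^e,f^e))=\max(\mathbf{1}_{(4,\infty)}(n^b),\mathbf{1}_{(F_{\mathrm{m}},\infty)}(f^b),\mathbf{1}_{(4,\infty)}(n^e),\mathbf{1}_{(F_{\mathrm{m}},\infty)}(f^e))$;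 - $\rho_{M^\rho}(\infty)=1$. *)

theory Defs
  imports Complex_Main "HOL-Library.Indicator_Function" "Graph_Theory.Arc_Walk"
begin

section \<open>Flight legs, connections and pairings\<close>

text \<open>
  Times are real numbers counted in days, so that the calendar day of an instant is its floor.
  Legs are elements of a type, so that distinct legs may share airports and times. The minimal
  duration of a connection is a function of the two legs: these determine the airport, the
  time and the fleet it may depend on. Flying durations only have to be in the same unit as
  the bounds \<open>max_flight\<close>. The fields \<open>max_flight\<close>, \<open>conn_cost\<close> and \<open>dual\<close> are
  the functions $F$, $c$ and $z$; \<open>first_day\<close> is the first of the four days of the period.
\<close>

record ('l, 'a) crew_pricing =
  legs :: "'l set"
  dep_airport :: "'l \<Rightarrow> 'a"
  arr_airport :: "'l \<Rightarrow> 'a"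
  dep_time :: "'l \<Rightarrow> real"
  arr_time :: "'l \<Rightarrow> real"
  flight_time :: "'l \<Rightarrow> real"
  paris :: "'a set"
  min_conn :: "'l \<Rightarrow> 'l \<Rightarrow> real"
  rest_threshold :: real
  max_flight :: "real \<Rightarrow> real"
  conn_cost :: "'l \<times> 'l \<Rightarrow> real"
  dual :: "'l \<Rightarrow> real"
  first_day :: int

text \<open>The last conjunct says that the maximum of \<open>max_flight\<close> exists.\<close>

definition valid_crew_pricing :: "('l, 'a) crew_pricing \<Rightarrow> bool" where
  "valid_crew_pricing I \<longleftrightarrow>
     (\<forall>l\<in>legs I. dep_time I l < arr_time I l) \<and>
     (\<forall>l\<in>legs I. 0 \<le> flight_time I l) \<and>
     (\<forall>l\<in>legs I. \<forall>l'\<in>legs I. 0 < min_conn I l l') \<and>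
     (\<forall>t. 0 \<le> max_flight I t) \<and>
     (\<exists>t0. \<forall>t. max_flight I t \<le> max_flight I t0)"

definition F_max :: "('l, 'a) crew_pricing \<Rightarrow> real" where
  "F_max I = (SUP t. max_flight I t)"

definition day :: "real \<Rightarrow> int" where
  "day t = \<lfloor>t\<rfloor>"

definition connection :: "('l, 'a) crew_pricing \<Rightarrow> 'l \<Rightarrow> 'l \<Rightarrow> bool" where
  "connection I l l' \<longleftrightarrow>
     l \<in> legs I \<and> l' \<in> legs I \<and> arr_airport I l = dep_airport I l' \<and>
     min_conn I l l' \<le> dep_time I l' - arr_time I l"

definition day_connection :: "('l, 'a) crew_pricing \<Rightarrow> 'l \<Rightarrow> 'l \<Rightarrow> bool" where
  "day_connection I l l' \<longleftrightarrow>
     connection I l l' \<and> day (arr_time I l) = day (dep_time I l')"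

definition night_connection :: "('l, 'a) crew_pricing \<Rightarrow> 'l \<Rightarrow> 'l \<Rightarrow> bool" where
  "night_connection I l l' \<longleftrightarrow>
     connection I l l' \<and> day (arr_time I l) \<noteq> day (dep_time I l')"

definition reduced_rest :: "('l, 'a) crew_pricing \<Rightarrow> 'l \<Rightarrow> 'l \<Rightarrow> bool" where
  "reduced_rest I l l' \<longleftrightarrow>
     night_connection I l l' \<and> dep_time I l' - arr_time I l < rest_threshold I"

definition pairing :: "('l, 'a) crew_pricing \<Rightarrow> 'l list \<Rightarrow> bool" where
  "pairing I p \<longleftrightarrow>
     p \<noteq> [] \<and> set p \<subseteq> legs I \<and> distinct p \<and> successively (connection I) p"

text \<open>
  A duty of \<open>p\<close> is a maximal block \<open>D\<close> of consecutive legs of \<open>p\<close> linked by day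
  connections; \<open>xs\<close> and \<open>ys\<close> are the parts of \<open>p\<close> before and after it. Lemma
  \<open>duty_same_day\<close> below says that this block is made of all the legs of \<open>p\<close> operated
  on one day, whenever no leg flies overnight.
\<close>

definition is_duty ::
    "('l, 'a) crew_pricing \<Rightarrow> 'l list \<Rightarrow> 'l list \<Rightarrow> 'l list \<Rightarrow> 'l list \<Rightarrow> bool" where
  "is_duty I p xs D ys \<longleftrightarrow>
     p = xs @ D @ ys \<and> D \<noteq> [] \<and> successively (day_connection I) D \<and>
     (xs \<noteq> [] \<longrightarrow> \<not> day_connection I (last xs) (hd D)) \<and>
     (ys \<noteq> [] \<longrightarrow> \<not> day_connection I (last D) (hd ys))"

text \<open>The span of at most 4 days is counted in calendar days, both ends included.\<close>

definition feasible :: "('l, 'a) crew_pricing \<Rightarrow> 'l list \<Rightarrow> bool" where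
  "feasible I p \<longleftrightarrow>
     pairing I p \<and>
     day (arr_time I (last p)) - day (dep_time I (hd p)) + 1 \<le> 4 \<and>
     dep_airport I (hd p) \<in> paris I \<and> arr_airport I (last p) \<in> paris I \<and>
     (\<forall>xs D ys. is_duty I p xs D ys \<longrightarrow>
        length D \<le> 4 \<and>
        (xs \<noteq> [] \<and> reduced_rest I (last xs) (hd D) \<longrightarrow> length D \<le> 3) \<and>
        (\<Sum>l\<leftarrow>D. flight_time I l) \<le> max_flight I (dep_time I (hd D)))"

definition reduced_cost :: "('l, 'a) crew_pricing \<Rightarrow> 'l list \<Rightarrow> real" where
  "reduced_cost I p =
     (\<Sum>a\<leftarrow>zip (butlast p) (tl p). conn_cost I a) + (\<Sum>l\<leftarrow>p. dual I l)"


section \<open>The digraph\<close>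

datatype 'l vertex = Origin | Leg 'l | Dest

text \<open>The legs of the four days are those operated entirely within these days.\<close>

definition period_legs :: "('l, 'a) crew_pricing \<Rightarrow> 'l set" where
  "period_legs I =
     {l \<in> legs I. first_day I \<le> day (dep_time I l) \<and> day (arr_time I l) \<le> first_day I + 3}"

definition pricing_digraph ::
    "('l, 'a) crew_pricing \<Rightarrow> ('l vertex, 'l vertex \<times> 'l vertex) pre_digraph" where
  "pricing_digraph I =
     \<lparr>verts = {Origin, Dest} \<union> Leg ` period_legs I,
      arcs =
        {(Origin, Leg l) | l. l \<in> period_legs I \<and> dep_airport I l \<in> paris I \<and>
                              day (dep_time I l) = first_day I} \<union>
        {(Leg l, Dest) | l. l \<in> period_legs I \<and> arr_airport I l \<in> paris I} \<union>
        {(Leg l, Leg l') | l l'. l \<in> period_legs I \<and> l' \<in> period_legs I \<and> connection I l l'},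
      tail = fst,
      head = snd\<rparr>"

definition od_path :: "('l, 'a) crew_pricing \<Rightarrow> ('l vertex \<times> 'l vertex) list \<Rightarrow> bool" where
  "od_path I P \<longleftrightarrow> pre_digraph.apath (pricing_digraph I) Origin P Dest"

definition path_legs :: "('l, 'a) crew_pricing \<Rightarrow> ('l vertex \<times> 'l vertex) list \<Rightarrow> 'l list" where
  "path_legs I P = [l. Leg l \<leftarrow> pre_digraph.awalk_verts (pricing_digraph I) Origin P]"


section \<open>The monoid and the resources\<close>

text \<open>
  \<open>Infeas\<close> is the element $\infty$. The real components of elements of the monoid are
  nonnegative, which is expressed by the carrier set \<open>M_rho\<close>.
\<close>

datatype rho_resource = Single nat real | Double nat real nat real | Infeas

definition M_rho :: "rho_resource set" where
  "M_rho = {Single n f | n f. 0 \<le> f} \<union>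
     {Double nb fb ne fe | nb fb ne fe. 0 \<le> fb \<and> 0 \<le> fe} \<union> {Infeas}"

fun rho_plus :: "real \<Rightarrow> rho_resource \<Rightarrow> rho_resource \<Rightarrow> rho_resource" where
  "rho_plus Fm Infeas r = Infeas"
| "rho_plus Fm r Infeas = Infeas"
| "rho_plus Fm (Single n f) (Single n' f') = Single (n + n') (f + f')"
| "rho_plus Fm (Single n f) (Double nb' fb' ne' fe') = Double (n + nb') (f + fb') ne' fe'"
| "rho_plus Fm (Double nb fb ne fe) (Single n' f') = Double nb fb (ne + n') (fe + f')"
| "rho_plus Fm (Double nb fb ne fe) (Double nb' fb' ne' fe') =
     (if ne + nb' > 4 \<or> fe + fb' > Fm then Infeas else Double nb fb ne' fe')"

type_synonym resource = "rho_resource \<times> real"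

definition resources :: "resource set" where
  "resources = M_rho \<times> UNIV"

definition res_plus :: "real \<Rightarrow> resource \<Rightarrow> resource \<Rightarrow> resource" where
  "res_plus Fm q q' = (rho_plus Fm (fst q) (fst q'), snd q + snd q')"

definition res_zero :: resource where
  "res_zero = (Single 0 0, 0)"

text \<open>The component $f^e$ of an arc whose head is the first leg of a duty.\<close>

definition duty_start_time :: "('l, 'a) crew_pricing \<Rightarrow> 'l \<Rightarrow> real" where
  "duty_start_time I l = flight_time I l + F_max I - max_flight I (dep_time I l)"

text \<open>Only the values at the arcs of the digraph matter.\<close>

fun arc_resource :: "('l, 'a) crew_pricing \<Rightarrow> 'l vertex \<times> 'l vertex \<Rightarrow> resource" where
  "arc_resource I (Leg l, Leg l') =
     (if day_connection I l l'
      then (Single 1 (flight_time I l'), conn_cost I (l, l') + dual I l')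
      else (Double 0 0 (if reduced_rest I l l' then 2 else 1) (duty_start_time I l'),
            conn_cost I (l, l') + dual I l'))"
| "arc_resource I (Origin, Leg l') = (Double 0 0 1 (duty_start_time I l'), dual I l')"
| "arc_resource I (Leg l, Dest) = (Double 0 0 0 0, 0)"
| "arc_resource I _ = undefined"

definition path_resource :: "('l, 'a) crew_pricing \<Rightarrow> ('l vertex \<times> 'l vertex) list \<Rightarrow> resource" where
  "path_resource I P = foldr (res_plus (F_max I)) (map (arc_resource I) P) res_zero"

definition cost :: "resource \<Rightarrow> real" where
  "cost q = snd q"

fun rho_infeas :: "real \<Rightarrow> rho_resource \<Rightarrow> nat" where
  "rho_infeas Fm (Single n f) = max (indicator {4<..} n) (indicator {Fm<..} f)"
| "rho_infeas Fm (Double nb fb ne fe) =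
     max (max (indicator {4<..} nb) (indicator {Fm<..} fb))
         (max (indicator {4<..} ne) (indicator {Fm<..} fe))"
| "rho_infeas Fm Infeas = 1"

definition infeas :: "('l, 'a) crew_pricing \<Rightarrow> resource \<Rightarrow> nat" where
  "infeas I q = rho_infeas (F_max I) (fst q)"


section \<open>Consistency of the definitions\<close>

lemma res_plus_assoc: "res_plus Fm (res_plus Fm q q') q'' = res_plus Fm q (res_plus Fm q' q'')"
  by (cases "fst q"; cases "fst q'"; cases "fst q''") (auto simp: res_plus_def add.assoc)

lemma res_plus_zero [simp]: "res_plus Fm res_zero q = q" "res_plus Fm q res_zero = q"
  by (cases q; cases "fst q"; force simp: res_plus_def res_zero_def)+

lemma res_plus_closed: "q \<in> resources \<Longrightarrow> q' \<in> resources \<Longrightarrow> res_plus Fm q q' \<in> resources"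
  by (cases q; cases q') (auto simp: resources_def M_rho_def res_plus_def split: if_splits)

lemma max_flight_le_F_max:
  assumes "valid_crew_pricing I"
  shows "max_flight I t \<le> F_max I"
proof -
  have "bdd_above (range (max_flight I))"
    using assms by (auto simp: valid_crew_pricing_def bdd_above_def)
  then show ?thesis
    unfolding F_max_def by (rule cSUP_upper[rotated]) simp
qed

lemma arc_resource_in_resources:
  assumes "valid_crew_pricing I" and "a \<in> arcs (pricing_digraph I)"
  shows "arc_resource I a \<in> resources"
proof -
  have "0 \<le> duty_start_time I l" "0 \<le> flight_time I l" if "l \<in> legs I" for l
  proof -
    show "0 \<le> flight_time I l"
      using assms(1) that by (simp add: valid_crew_pricing_def)
    then show "0 \<le> duty_start_time I l"
      using max_flight_le_F_max[OF assms(1), of "dep_time I l"]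
      by (simp add: duty_start_time_def)
  qed
  then show ?thesis
    using assms(2) by (auto simp: pricing_digraph_def period_legs_def resources_def M_rho_def)
qed

text \<open>
  Departure times increase along connections, so every walk from the origin to the
  destination is a path: it is immaterial whether paths may repeat vertices.
\<close>

lemma connection_dep_time:
  assumes "valid_crew_pricing I" and "connection I l l'"
  shows "arr_time I l < dep_time I l'" "dep_time I l < dep_time I l'"
proof -
  have "0 < min_conn I l l'" "dep_time I l < arr_time I l"
    using assms by (auto simp: valid_crew_pricing_def connection_def)
  then show "arr_time I l < dep_time I l'" "dep_time I l < dep_time I l'"
    using assms(2) by (auto simp: connection_def)
qed

lemma awalk_from_leg:
  assumes valid: "valid_crew_pricing I"
    and "pre_digraph.awalk (pricing_digraph I) (Leg l) P Dest"
  shows "distinct (pre_digraph.awalk_verts (pricing_digraph I) (Leg l) P) \<and>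
    Origin \<notin> set (pre_digraph.awalk_verts (pricing_digraph I) (Leg l) P) \<and>
    (\<forall>m. Leg m \<in> set (pre_digraph.awalk_verts (pricing_digraph I) (Leg l) P) \<longrightarrow>
       dep_time I l \<le> dep_time I m)"
  using assms(2)
proof (induction P arbitrary: l)
  case Nil
  then show ?case
    by (simp add: pre_digraph.awalk_def pre_digraph.cas.simps)
next
  case (Cons a P)
  let ?G = "pricing_digraph I"
  have a: "a \<in> arcs ?G" "fst a = Leg l" and cas: "pre_digraph.cas ?G (snd a) P Dest"
    and P: "set P \<subseteq> arcs ?G"
    using Cons.prems
    by (auto simp: pre_digraph.awalk_def pre_digraph.cas.simps pricing_digraph_def)
  have vs: "pre_digraph.awalk_verts ?G (Leg l) (a # P) =
      Leg l # pre_digraph.awalk_verts ?G (snd a) P"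
    using a(2) by (simp add: pre_digraph.awalk_verts.simps pricing_digraph_def)
  consider (dest) "snd a = Dest"
    | (leg) l' where "snd a = Leg l'" "l' \<in> period_legs I" "connection I l l'"
    using a by (auto simp: pricing_digraph_def)
  then show ?case
  proof cases
    case dest
    then have "P = []"
      using cas P
      by (cases P) (auto simp: pre_digraph.cas.simps pricing_digraph_def)
    then show ?thesis
      using dest vs by (simp add: pre_digraph.awalk_verts.simps)
  next
    case leg
    have "pre_digraph.awalk ?G (Leg l') P Dest"
      using leg cas P by (auto simp: pre_digraph.awalk_def pricing_digraph_def)
    from Cons.IH[OF this] show ?thesis
      using connection_dep_time(2)[OF valid leg(3)] leg(1) vs by fastforce
  qed
qed

lemma od_path_iff_awalk:
  assumes "valid_crew_pricing I"
  shows "od_path I P \<longleftrightarrow> pre_digraph.awalk (pricing_digraph I) Origin P Dest"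
proof
  let ?G = "pricing_digraph I"
  assume w: "pre_digraph.awalk ?G Origin P Dest"
  then obtain a P' where P: "P = a # P'"
    by (cases P) (auto simp: pre_digraph.awalk_def pre_digraph.cas.simps)
  have a: "a \<in> arcs ?G" "fst a = Origin" and cas: "pre_digraph.cas ?G (snd a) P' Dest"
    and P': "set P' \<subseteq> arcs ?G"
    using w P by (auto simp: pre_digraph.awalk_def pre_digraph.cas.simps pricing_digraph_def)
  obtain l where l: "snd a = Leg l" "l \<in> period_legs I"
    using a by (auto simp: pricing_digraph_def)
  have "pre_digraph.awalk ?G (Leg l) P' Dest"
    using l cas P' by (auto simp: pre_digraph.awalk_def pricing_digraph_def)
  from awalk_from_leg[OF assms this]
  have "distinct (pre_digraph.awalk_verts ?G Origin P)"
    using P a(2) l(1) by (simp add: pre_digraph.awalk_verts.simps pricing_digraph_def)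
  then show "od_path I P"
    using w by (simp add: od_path_def pre_digraph.apath_def)
qed (simp add: od_path_def pre_digraph.apath_def)

lemma successively_connection_sorted:
  assumes "valid_crew_pricing I" and "successively (connection I) p"
  shows "sorted_wrt (\<lambda>l l'. arr_time I l < dep_time I l') p"
  using assms(2)
proof (induction p rule: induct_list012)
  case (3 l l' p)
  then have c: "connection I l l'"
    and s: "sorted_wrt (\<lambda>l l'. arr_time I l < dep_time I l') (l' # p)"
    by auto
  have "arr_time I l < dep_time I l'" "dep_time I l' < arr_time I l'"
    using connection_dep_time[OF assms(1) c] c assms(1)
    by (auto simp: valid_crew_pricing_def connection_def)
  then show ?case
    using s by fastforce
qed auto

lemma duty_same_day:
  assumes valid: "valid_crew_pricing I" and p: "pairing I p" and d: "is_duty I p xs D ys"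
    and same: "\<forall>l\<in>set p. day (dep_time I l) = day (arr_time I l)"
  shows "D = filter (\<lambda>l. day (dep_time I l) = day (dep_time I (hd D))) p"
proof -
  let ?k = "day (dep_time I (hd D))"
  have pe: "p = xs @ D @ ys" and D: "D \<noteq> []" and sD: "successively (day_connection I) D"
    and xs: "xs \<noteq> [] \<Longrightarrow> \<not> day_connection I (last xs) (hd D)"
    and ys: "ys \<noteq> [] \<Longrightarrow> \<not> day_connection I (last D) (hd ys)"
    using d by (auto simp: is_duty_def)
  have sorted: "sorted_wrt (\<lambda>l l'. arr_time I l < dep_time I l') p"
    using p by (intro successively_connection_sorted[OF valid]) (simp add: pairing_def)
  have legs: "dep_time I l < arr_time I l" if "l \<in> set p" for l
    using that p valid by (auto simp: pairing_def valid_crew_pricing_def)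
  have day_mono: "day s \<le> day t" if "s \<le> t" for s t
    using that by (simp add: day_def floor_mono)
  have D_day: "day (dep_time I l) = day (dep_time I (hd E))"
    if "successively (day_connection I) E" "set E \<subseteq> set p" "l \<in> set E" for l E
    using that
  proof (induction E rule: induct_list012)
    case (3 x y E)
    then have "day (dep_time I x) = day (dep_time I y)"
      using same by (auto simp: day_connection_def)
    with 3 show ?case by auto
  qed auto
  have inD: "day (dep_time I l) = ?k" if "l \<in> set D" for l
    using D_day[OF sD _ that] pe by auto
  have in_xs: "day (dep_time I l) \<noteq> ?k" if "l \<in> set xs" for l
  proof -
    have ne: "xs \<noteq> []" using that by auto
    have cl: "connection I (last xs) (hd D)"
      using p pe D ne by (auto simp: pairing_def successively_append_iff)
    then have "day (arr_time I (last xs)) \<noteq> ?k"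
      using xs[OF ne] by (simp add: day_connection_def)
    moreover have "day (arr_time I (last xs)) \<le> ?k"
      using connection_dep_time(1)[OF valid cl] by (intro day_mono) simp
    moreover have "dep_time I l \<le> arr_time I (last xs)"
    proof (cases "l = last xs")
      case True
      then show ?thesis using legs[of l] that pe by simp
    next
      case False
      have "xs = butlast xs @ [last xs]" using ne by simp
      then have "l \<in> set (butlast xs)" using that False
        by (metis UnE empty_iff empty_set set_ConsD set_append)
      moreover have "sorted_wrt (\<lambda>l l'. arr_time I l < dep_time I l') (butlast xs @ [last xs])"
        using sorted pe ne by (simp add: sorted_wrt_append)
      ultimately have "arr_time I l < dep_time I (last xs)"
        by (simp add: sorted_wrt_append)
      then show ?thesis using legs[of l] legs[of "last xs"] that pe ne by simp
    qed
    then have "day (dep_time I l) \<le> day (arr_time I (last xs))" by (rule day_mono)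
    ultimately show ?thesis by linarith
  qed
  have in_ys: "day (dep_time I l) \<noteq> ?k" if "l \<in> set ys" for l
  proof -
    have ne: "ys \<noteq> []" using that by auto
    have cl: "connection I (last D) (hd ys)"
      using p pe D ne by (auto simp: pairing_def successively_append_iff)
    have "day (arr_time I (last D)) = ?k"
      using same inD[of "last D"] D pe by auto
    then have "?k \<noteq> day (dep_time I (hd ys))"
      using ys[OF ne] cl by (simp add: day_connection_def)
    moreover have "?k \<le> day (dep_time I (hd ys))"
      using connection_dep_time(1)[OF valid cl] \<open>day (arr_time I (last D)) = ?k\<close>
      by (metis day_mono less_imp_le)
    moreover have "dep_time I (hd ys) \<le> dep_time I l"
    proof (cases ys)
      case (Cons y zs)
      then show ?thesis
        using sorted pe that legs[of y] by (fastforce simp: sorted_wrt_append)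
    qed (use ne in simp)
    then have "day (dep_time I (hd ys)) \<le> day (dep_time I l)" by (rule day_mono)
    ultimately show ?thesis by linarith
  qed
  show ?thesis
    unfolding pe using inD in_xs in_ys by (simp add: filter_empty_conv filter_id_conv)
qed

end

theory Submission
  imports Defs
begin

text \<open>
  The resource of a path is read from its destination backwards. Behind a leg \<open>l\<close>, the
  arcs up to the destination sum to a \<open>Double\<close> whose first half counts the legs and the flying
  time that still belong to the duty of \<open>l\<close>, or to \<open>Infeas\<close> as soon as a later
  duty breaks a limit (lemma \<open>fst_suffix_resource\<close>). This works because only the arcs that
  enter a duty (night connections and the arc from the origin) and the arc to the destination
  carry a \<open>Double\<close>. So the operation \<open>rho_plus\<close> makes a comparison exactly where a duty
  ends, and compares the entry of the duty plus its day connections with \<open>4\<close> and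
  \<open>F_max I\<close>. The entry is set so that this comparison is the right one: it counts the
  first leg, counts one leg more after a reduced rest, which turns the limit 4 into 3, and adds
  \<open>F_max I - F(t)\<close> to the flying time, which turns the limit \<open>F_max I\<close> into
  \<open>F(t)\<close> (lemma \<open>rho_plus_duty_entry\<close>).

  As the path begins and ends with a \<open>Double\<close>, its resource is \<open>Infeas\<close> or the
  \<open>Double\<close> with zero entries; hence infeasibility \<open>0\<close> means that all duties are within
  the limits. The other requirements on a pairing hold for every path of the digraph: the
  arcs at the origin and at the destination force the two ends into Paris, all legs lie in the
  four days, and legs cannot repeat, because time increases along connections. The equality of
  costs only compares the summands of both sides and holds for every path.
\<close>

section \<open>The legs of a path\<close>

fun legs_walk :: "'l \<Rightarrow> 'l list \<Rightarrow> ('l vertex \<times> 'l vertex) list" where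
  "legs_walk l [] = [(Leg l, Dest)]"
| "legs_walk l (l' # ls) = (Leg l, Leg l') # legs_walk l' ls"

lemma awalk_from_leg_legs:
  assumes "pre_digraph.awalk (pricing_digraph I) (Leg l) P Dest"
  shows "\<exists>ls. P = legs_walk l ls \<and>
    pre_digraph.awalk_verts (pricing_digraph I) (Leg l) P = map Leg (l # ls) @ [Dest] \<and>
    set (l # ls) \<subseteq> period_legs I \<and> successively (connection I) (l # ls) \<and>
    arr_airport I (last (l # ls)) \<in> paris I"
  using assms
proof (induction P arbitrary: l)
  case Nil
  then show ?case
    by (simp add: pre_digraph.awalk_def pre_digraph.cas.simps)
next
  case (Cons a P)
  let ?G = "pricing_digraph I"
  have a: "a \<in> arcs ?G" "fst a = Leg l" and cas: "pre_digraph.cas ?G (snd a) P Dest"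
    and P: "set P \<subseteq> arcs ?G"
    using Cons.prems
    by (auto simp: pre_digraph.awalk_def pre_digraph.cas.simps pricing_digraph_def)
  have vs: "pre_digraph.awalk_verts ?G (Leg l) (a # P) =
      Leg l # pre_digraph.awalk_verts ?G (snd a) P"
    using a(2) by (simp add: pre_digraph.awalk_verts.simps pricing_digraph_def)
  consider (dest) "a = (Leg l, Dest)" "l \<in> period_legs I" "arr_airport I l \<in> paris I"
    | (leg) l' where "a = (Leg l, Leg l')" "l \<in> period_legs I" "l' \<in> period_legs I"
        "connection I l l'"
    using a by (auto simp: pricing_digraph_def)
  then show ?case
  proof cases
    case dest
    \<comment> \<open>no arc leaves the destination\<close>
    then have "P = []"
      using cas P by (cases P) (auto simp: pre_digraph.cas.simps pricing_digraph_def)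
    then show ?thesis
      using dest vs by (intro exI[of _ "[]"]) (simp add: pre_digraph.awalk_verts.simps)
  next
    case leg
    have "pre_digraph.awalk ?G (Leg l') P Dest"
      using leg cas P by (auto simp: pre_digraph.awalk_def pricing_digraph_def)
    from Cons.IH[OF this] obtain ls where ls: "P = legs_walk l' ls"
        "pre_digraph.awalk_verts ?G (Leg l') P = map Leg (l' # ls) @ [Dest]"
        "set (l' # ls) \<subseteq> period_legs I" "successively (connection I) (l' # ls)"
        "arr_airport I (last (l' # ls)) \<in> paris I"
      by blast
    have "pre_digraph.awalk_verts ?G (Leg l) (a # P) = map Leg (l # l' # ls) @ [Dest]"
      using leg(1) ls(2) vs by simp
    moreover have "a # P = legs_walk l (l' # ls)"
      using leg(1) ls(1) by simp
    moreover have "set (l # l' # ls) \<subseteq> period_legs I" "successively (connection I) (l # l' # ls)"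
        "arr_airport I (last (l # l' # ls)) \<in> paris I"
      using leg ls(3-5) by simp_all
    ultimately show ?thesis by blast
  qed
qed

lemma concat_map_Leg: "[l. Leg l \<leftarrow> map Leg ls] = ls"
  by (induction ls) auto

lemma od_path_legs:
  assumes "od_path I P"
  obtains l ls where "P = (Origin, Leg l) # legs_walk l ls" "path_legs I P = l # ls"
    "set (l # ls) \<subseteq> period_legs I" "successively (connection I) (l # ls)"
    "dep_airport I l \<in> paris I" "day (dep_time I l) = first_day I"
    "arr_airport I (last (l # ls)) \<in> paris I"
proof -
  let ?G = "pricing_digraph I"
  have w: "pre_digraph.awalk ?G Origin P Dest"
    using assms by (simp add: od_path_def pre_digraph.apath_def)
  then obtain a P' where P: "P = a # P'"
    by (cases P) (auto simp: pre_digraph.awalk_def pre_digraph.cas.simps)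
  have a: "a \<in> arcs ?G" "fst a = Origin" and cas: "pre_digraph.cas ?G (snd a) P' Dest"
    and P': "set P' \<subseteq> arcs ?G"
    using w P by (auto simp: pre_digraph.awalk_def pre_digraph.cas.simps pricing_digraph_def)
  obtain l where l: "a = (Origin, Leg l)" "l \<in> period_legs I" "dep_airport I l \<in> paris I"
      "day (dep_time I l) = first_day I"
    using a by (auto simp: pricing_digraph_def)
  have "pre_digraph.awalk ?G (Leg l) P' Dest"
    using l cas P' by (auto simp: pre_digraph.awalk_def pricing_digraph_def)
  from awalk_from_leg_legs[OF this] obtain ls where ls: "P' = legs_walk l ls"
      "pre_digraph.awalk_verts ?G (Leg l) P' = map Leg (l # ls) @ [Dest]"
      "set (l # ls) \<subseteq> period_legs I" "successively (connection I) (l # ls)"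
      "arr_airport I (last (l # ls)) \<in> paris I"
    by blast
  have "pre_digraph.awalk_verts ?G Origin P = Origin # map Leg (l # ls) @ [Dest]"
    using P l(1) ls(2) by (simp add: pre_digraph.awalk_verts.simps pricing_digraph_def)
  then have "path_legs I P = l # ls"
    using concat_map_Leg[of "l # ls"] by (simp add: path_legs_def)
  with that P l ls show ?thesis by blast
qed

lemma distinct_connections:
  assumes "valid_crew_pricing I" and "set p \<subseteq> legs I" and "successively (connection I) p"
  shows "distinct p"
proof -
  have "sorted_wrt (\<lambda>l l'. arr_time I l < dep_time I l') p"
    using assms by (intro successively_connection_sorted)
  moreover have "\<not> arr_time I l < dep_time I l" if "l \<in> set p" for l
    using that assms(1,2) by (auto simp: valid_crew_pricing_def not_less less_imp_le)
  ultimately show ?thesis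
    by (induction p) auto
qed


section \<open>The duties of a sequence of legs\<close>

fun duty_rest :: "('l, 'a) crew_pricing \<Rightarrow> 'l \<Rightarrow> 'l list \<Rightarrow> 'l list" where
  "duty_rest I l [] = []"
| "duty_rest I l (l' # ls) = (if day_connection I l l' then l' # duty_rest I l' ls else [])"

lemma is_duty_singleton: "is_duty I [l] xs D ys \<longleftrightarrow> xs = [] \<and> D = [l] \<and> ys = []"
  by (cases xs; cases D) (auto simp: is_duty_def)

text \<open>
  The next two lemmas follow the effect on duties of putting a leg \<open>l\<close> in front:
  a day connection lengthens the first duty by \<open>l\<close>, and a night connection makes
  \<open>l\<close> a duty by itself. They are the induction steps that match the backward summation of
  resources.
\<close>

lemma is_duty_Cons_night:
  assumes "\<not> day_connection I l l'"
  shows "is_duty I (l # l' # ls) xs D ys \<longleftrightarrow>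
    xs = [] \<and> D = [l] \<and> ys = l' # ls \<or>
    (\<exists>xs'. xs = l # xs' \<and> is_duty I (l' # ls) xs' D ys)"
proof (cases xs)
  case Nil
  show ?thesis
  proof (cases D)
    case (Cons m D')
    with Nil assms show ?thesis by (cases D') (auto simp: is_duty_def)
  qed (simp add: is_duty_def Nil)
next
  case (Cons m xs')
  with assms show ?thesis
    by (cases xs'; cases D) (auto simp: is_duty_def)
qed

lemma is_duty_Cons_day:
  assumes "day_connection I l l'"
  shows "is_duty I (l # l' # ls) xs D ys \<longleftrightarrow>
    xs = [] \<and> (\<exists>D'. D = l # D' \<and> is_duty I (l' # ls) [] D' ys) \<or>
    (\<exists>xs'. xs = l # xs' \<and> xs' \<noteq> [] \<and> is_duty I (l' # ls) xs' D ys)"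
proof (cases xs)
  case Nil
  show ?thesis
  proof (cases D)
    case (Cons m D')
    with Nil assms show ?thesis by (cases D') (auto simp: is_duty_def)
  qed (simp add: is_duty_def Nil)
next
  case (Cons m xs')
  with assms show ?thesis
    by (cases xs'; cases D) (auto simp: is_duty_def)
qed

lemma first_duty_iff: "(\<exists>ys. is_duty I (l # ls) [] D ys) \<longleftrightarrow> D = l # duty_rest I l ls"
proof (induction ls arbitrary: l D)
  case Nil
  then show ?case by (simp add: is_duty_singleton)
next
  case (Cons l' ls)
  show ?case
  proof (cases "day_connection I l l'")
    case True
    have "(\<exists>ys. is_duty I (l # l' # ls) [] D ys) \<longleftrightarrow>
        (\<exists>D'. D = l # D' \<and> (\<exists>ys. is_duty I (l' # ls) [] D' ys))"
      using is_duty_Cons_day[OF True] by auto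
    with True show ?thesis by (simp add: Cons.IH)
  next
    case False
    then show ?thesis by (simp add: is_duty_Cons_night)
  qed
qed

text \<open>
  The maximality of a duty determines the first one, so a condition on all duties is one on
  the run of day connections at the front and one on the duties that have a predecessor.
\<close>

lemma all_duties_split_first:
  "(\<forall>xs D ys. is_duty I (l # ls) xs D ys \<longrightarrow> Q xs D) \<longleftrightarrow>
   Q [] (l # duty_rest I l ls) \<and>
   (\<forall>xs D ys. is_duty I (l # ls) xs D ys \<and> xs \<noteq> [] \<longrightarrow> Q xs D)"
proof -
  have "(\<forall>D ys. is_duty I (l # ls) [] D ys \<longrightarrow> Q [] D) \<longleftrightarrow>
      (\<forall>D. (\<exists>ys. is_duty I (l # ls) [] D ys) \<longrightarrow> Q [] D)"
    by simp
  also have "\<dots> \<longleftrightarrow> Q [] (l # duty_rest I l ls)"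
    unfolding first_duty_iff by simp
  finally have first: "(\<forall>D ys. is_duty I (l # ls) [] D ys \<longrightarrow> Q [] D) \<longleftrightarrow>
      Q [] (l # duty_rest I l ls)" .
  have "(\<forall>xs. R xs) \<longleftrightarrow> R [] \<and> (\<forall>xs. xs \<noteq> [] \<longrightarrow> R xs)" for R :: "'a list \<Rightarrow> bool"
    by metis
  from this[of "\<lambda>xs. \<forall>D ys. is_duty I (l # ls) xs D ys \<longrightarrow> Q xs D"] show ?thesis
    unfolding first by blast
qed

text \<open>The flag \<open>r\<close> tells whether the duty follows a reduced rest.\<close>

definition within_limits :: "('l, 'a) crew_pricing \<Rightarrow> bool \<Rightarrow> 'l list \<Rightarrow> bool" where
  "within_limits I r D \<longleftrightarrow>
     length D \<le> (if r then 3 else 4) \<and>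
     (\<Sum>l\<leftarrow>D. flight_time I l) \<le> max_flight I (dep_time I (hd D))"

text \<open>
  The first duty is left out: its limits depend on the arc that enters it, which lies before
  \<open>p\<close> when \<open>p\<close> is the end of a longer pairing.
\<close>

definition later_duties_ok :: "('l, 'a) crew_pricing \<Rightarrow> 'l list \<Rightarrow> bool" where
  "later_duties_ok I p \<longleftrightarrow>
     (\<forall>xs D ys. is_duty I p xs D ys \<and> xs \<noteq> [] \<longrightarrow>
        within_limits I (reduced_rest I (last xs) (hd D)) D)"

lemma later_duties_ok_singleton: "later_duties_ok I [l]"
  by (simp add: later_duties_ok_def is_duty_singleton)

lemma later_duties_ok_day:
  assumes "day_connection I l l'"
  shows "later_duties_ok I (l # l' # ls) \<longleftrightarrow> later_duties_ok I (l' # ls)"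
proof -
  have eq: "is_duty I (l # l' # ls) xs D ys \<and> xs \<noteq> [] \<longleftrightarrow>
      (\<exists>xs'. xs = l # xs' \<and> is_duty I (l' # ls) xs' D ys \<and> xs' \<noteq> [])" for xs D ys
    using is_duty_Cons_day[OF assms] by auto
  have "later_duties_ok I (l # l' # ls) \<longleftrightarrow>
      (\<forall>xs' D ys. is_duty I (l' # ls) xs' D ys \<and> xs' \<noteq> [] \<longrightarrow>
        within_limits I (reduced_rest I (last (l # xs')) (hd D)) D)"
    unfolding later_duties_ok_def eq by blast
  also have "\<dots> \<longleftrightarrow> later_duties_ok I (l' # ls)"
    unfolding later_duties_ok_def by simp
  finally show ?thesis .
qed

text \<open>
  After a night connection the former first duty has a predecessor, so it joins the duties
  that are checked; the connection decides which limit applies to it.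
\<close>

lemma later_duties_ok_night:
  assumes "\<not> day_connection I l l'"
  shows "later_duties_ok I (l # l' # ls) \<longleftrightarrow>
    within_limits I (reduced_rest I l l') (l' # duty_rest I l' ls) \<and>
    later_duties_ok I (l' # ls)"
proof -
  have "later_duties_ok I (l # l' # ls) \<longleftrightarrow>
      (\<forall>xs D ys. is_duty I (l' # ls) xs D ys \<longrightarrow>
        within_limits I (reduced_rest I (last (l # xs)) (hd D)) D)"
    unfolding later_duties_ok_def is_duty_Cons_night[OF assms] by blast
  also have "\<dots> \<longleftrightarrow>
      within_limits I (reduced_rest I l l') (l' # duty_rest I l' ls) \<and>
      later_duties_ok I (l' # ls)"
    unfolding later_duties_ok_def by (subst all_duties_split_first) simp
  finally show ?thesis .
qed

lemma all_duties_iff: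
  "(\<forall>xs D ys. is_duty I (l # ls) xs D ys \<longrightarrow>
      length D \<le> 4 \<and>
      (xs \<noteq> [] \<and> reduced_rest I (last xs) (hd D) \<longrightarrow> length D \<le> 3) \<and>
      (\<Sum>l\<leftarrow>D. flight_time I l) \<le> max_flight I (dep_time I (hd D))) \<longleftrightarrow>
   within_limits I False (l # duty_rest I l ls) \<and> later_duties_ok I (l # ls)"
  (is "?all \<longleftrightarrow> _")
proof -
  have "within_limits I r D \<longleftrightarrow> length D \<le> 4 \<and> (r \<longrightarrow> length D \<le> 3) \<and>
      (\<Sum>l\<leftarrow>D. flight_time I l) \<le> max_flight I (dep_time I (hd D))" for r D
    by (auto simp: within_limits_def)
  then have "?all \<longleftrightarrow> (\<forall>xs D ys. is_duty I (l # ls) xs D ys \<longrightarrow>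
      within_limits I (xs \<noteq> [] \<and> reduced_rest I (last xs) (hd D)) D)"
    by simp
  also have "\<dots> \<longleftrightarrow>
      within_limits I False (l # duty_rest I l ls) \<and> later_duties_ok I (l # ls)"
    unfolding later_duties_ok_def by (subst all_duties_split_first) simp
  finally show ?thesis .
qed


section \<open>The resource of a path\<close>

text \<open>
  The reason for the shift by \<open>F_max I - F(t)\<close> and for the value 2 after a reduced rest:
  with them, the uniform test of \<open>rho_plus\<close> is the test of the limits of this very duty.
\<close>

lemma rho_plus_duty_entry:
  "rho_plus (F_max I) (Double 0 0 (if r then 2 else 1) (duty_start_time I l))
     (Double (length D) (\<Sum>l\<leftarrow>D. flight_time I l) 0 0) =
   (if within_limits I r (l # D) then Double 0 0 0 0 else Infeas)"
  by (auto simp: within_limits_def duty_start_time_def)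

text \<open>
  The leg \<open>l\<close> itself is counted by the arc that enters it, so the first half of the
  \<open>Double\<close> holds only the legs after \<open>l\<close>. The second half is zero because the last arc
  leads to the destination.
\<close>

lemma fst_suffix_resource:
  "fst (path_resource I (legs_walk l ls)) =
     (if later_duties_ok I (l # ls)
      then Double (length (duty_rest I l ls)) (\<Sum>m\<leftarrow>duty_rest I l ls. flight_time I m) 0 0
      else Infeas)"
proof (induction ls arbitrary: l)
  case Nil
  then show ?case
    by (simp add: path_resource_def res_plus_def res_zero_def later_duties_ok_singleton)
next
  case (Cons l' ls)
  have step: "fst (path_resource I (legs_walk l (l' # ls))) =
      rho_plus (F_max I) (fst (arc_resource I (Leg l, Leg l')))
        (fst (path_resource I (legs_walk l' ls)))"
    by (simp add: path_resource_def res_plus_def)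
  show ?case
  proof (cases "day_connection I l l'")
    case True
    then show ?thesis
      by (simp only: step Cons.IH later_duties_ok_day) simp
  next
    case False
    then show ?thesis
      unfolding step Cons.IH later_duties_ok_night[OF False]
      by (simp add: rho_plus_duty_entry del: rho_plus.simps(7))
  qed
qed

lemma snd_suffix_resource:
  "snd (path_resource I (legs_walk l ls)) + dual I l = reduced_cost I (l # ls)"
proof (induction ls arbitrary: l)
  case Nil
  then show ?case
    by (simp add: path_resource_def res_plus_def res_zero_def reduced_cost_def)
next
  case (Cons l' ls)
  have "snd (path_resource I (legs_walk l (l' # ls))) =
      conn_cost I (l, l') + dual I l' + snd (path_resource I (legs_walk l' ls))"
    by (simp add: path_resource_def res_plus_def)
  with Cons.IH[of l'] show ?case
    by (simp add: reduced_cost_def)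
qed

text \<open>
  The arc from the origin enters the first duty like a night connection that is no reduced
  rest. Its zero first half is what makes every path resource other than \<open>Infeas\<close> have
  infeasibility \<open>0\<close>, since \<open>F_max I\<close> is nonnegative.
\<close>

lemma infeas_od_path:
  assumes "valid_crew_pricing I"
  shows "infeas I (path_resource I ((Origin, Leg l) # legs_walk l ls)) = 0 \<longleftrightarrow>
    within_limits I False (l # duty_rest I l ls) \<and> later_duties_ok I (l # ls)"
proof -
  have "0 \<le> F_max I"
    using assms max_flight_le_F_max[OF assms, of 0]
    by (auto simp: valid_crew_pricing_def intro: order_trans)
  moreover have "fst (path_resource I ((Origin, Leg l) # legs_walk l ls)) =
      rho_plus (F_max I) (Double 0 0 1 (duty_start_time I l))
        (fst (path_resource I (legs_walk l ls)))"
    by (simp add: path_resource_def res_plus_def)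
  moreover note rho_plus_duty_entry[of I False l "duty_rest I l ls"]
  ultimately show ?thesis
    by (simp add: infeas_def fst_suffix_resource del: rho_plus.simps(7))
qed

theorem proposition5:
  fixes I :: "('l, 'a) crew_pricing"
    and P :: "('l vertex \<times> 'l vertex) list"
  assumes "valid_crew_pricing I"
    and "od_path I P"
  shows "(feasible I (path_legs I P) \<longleftrightarrow> infeas I (path_resource I P) = 0) \<and>
         (feasible I (path_legs I P) \<longrightarrow>
            cost (path_resource I P) = reduced_cost I (path_legs I P))"
proof -
  obtain l ls where P: "P = (Origin, Leg l) # legs_walk l ls"
    and p: "path_legs I P = l # ls"
    and period: "set (l # ls) \<subseteq> period_legs I"
    and conn: "successively (connection I) (l # ls)"
    and dep: "dep_airport I l \<in> paris I" "day (dep_time I l) = first_day I"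
    and arr: "arr_airport I (last (l # ls)) \<in> paris I"
    using od_path_legs[OF assms(2)] .
  have legs: "set (l # ls) \<subseteq> legs I"
    using period by (auto simp: period_legs_def)
  have "pairing I (l # ls)"
    using distinct_connections[OF assms(1) legs conn] legs conn by (simp add: pairing_def)
  moreover have "day (arr_time I (last (l # ls))) \<le> first_day I + 3"
    using period last_in_set[of "l # ls"] by (auto simp: period_legs_def)
  ultimately have "feasible I (l # ls) \<longleftrightarrow>
      within_limits I False (l # duty_rest I l ls) \<and> later_duties_ok I (l # ls)"
    unfolding feasible_def all_duties_iff using dep arr by simp
  then have "feasible I (path_legs I P) \<longleftrightarrow> infeas I (path_resource I P) = 0"
    using infeas_od_path[OF assms(1)] P p by simp
  moreover have "cost (path_resource I P) = reduced_cost I (path_legs I P)"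
  proof -
    have "snd (path_resource I P) = dual I l + snd (path_resource I (legs_walk l ls))"
      by (simp add: P path_resource_def res_plus_def)
    with snd_suffix_resource[of I l ls] p show ?thesis
      by (simp add: cost_def)
  qed
  ultimately show ?thesis by simp
qed

end
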